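(* Let $(M,\rho)$ be a compact metric space and let $f\colon M\to M$ be an expansive homeomorphism. Then $f$ admits a self-similar metric: there are a metric $\mathrm{d}$ on $M$ inducing the same topology as $\rho$ and constants $\xi>0$ and $\lambda>1$ such that for all $p,q\in M$ with $\mathrm{d}(p,q)\le\xi$, $$\max\{\mathrm{d}(f(p),f(q)),\ \mathrm{d}(f^{-1}(p),f^{-1}(q))\}=\lambda\,\mathrm{d}(p,q).$$
   Context: A homeomorphism $f\colon M\to M$ of a compact metric space $(M,\rho)$ is expansive if there is $\eta>0$ such that for all $x\neq y$ in $M$ there is $n\in\mathbb{Z}$ with $\rho(f^n(x),f^n(y))>\eta$. *)

theory Defs
  imports "HOL-Analysis.Analysis"
begin

text \<open>The iterate \<open>f\<^sup>n\<close>, \<open>n \<in> \<int>\<close>, of a bijection \<open>f\<close> of \<open>M\<close>; the inverse is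
  taken on the carrier \<open>M\<close>, so the values of \<open>f\<close> outside \<open>M\<close> play no role at points of \<open>M\<close>.\<close>
definition int_iterate :: "'a set \<Rightarrow> ('a \<Rightarrow> 'a) \<Rightarrow> int \<Rightarrow> 'a \<Rightarrow> 'a" where
  "int_iterate M f n =
     (if 0 \<le> n then f ^^ nat n else inv_into M f ^^ nat (- n))"

text \<open>Meant for \<open>f\<close> a homeomorphism of the compact metric space \<open>(M, \<rho>)\<close>; compactness and
  \<open>f\<close> being a homeomorphism are separate assumptions.\<close>
definition expansive :: "'a set \<Rightarrow> ('a \<Rightarrow> 'a \<Rightarrow> real) \<Rightarrow> ('a \<Rightarrow> 'a) \<Rightarrow> bool" where
  "expansive M \<rho> f \<longleftrightarrow>
     (\<exists>\<eta>>0. \<forall>x\<in>M. \<forall>y\<in>M. x \<noteq> y \<longrightarrow>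
        (\<exists>n::int. \<rho> (int_iterate M f n x) (int_iterate M f n y) > \<eta>))"

end

theory Submission
  imports Defs
begin

text \<open>
  For distinct points \<open>x\<close>, \<open>y\<close> let \<open>N x y\<close> (\<open>sep_time\<close> below) be the least \<open>\<bar>k\<bar>\<close> at which the iterates
  \<open>f\<^sup>k x\<close> and \<open>f\<^sup>k y\<close> are more than the expansivity constant \<open>\<eta>\<close> apart. Applying \<open>f\<^sup>k\<close> changes \<open>N\<close> by
  at most \<open>\<bar>k\<bar>\<close>, and one of \<open>f\<close>, \<open>f\<^sup>-\<^sup>1\<close> lowers a positive \<open>N\<close> by exactly one; so a power of a
  fixed base with exponent \<open>- N x y\<close> would be self-similar, were it only a metric.

  Compactness makes it nearly one: two points at distance at least \<open>\<eta> / 3\<close> separate within a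
  uniform time \<open>m\<close> (\<open>uniform_separation\<close>), and therefore \<open>N w z\<close> cannot be smaller than the
  minimum of \<open>N w x\<close>, \<open>N x y\<close>, \<open>N y z\<close> by more than \<open>m\<close> (\<open>sep_time_triangle3\<close>). For a number
  \<open>l > 1\<close> (called \<open>growth\<close> below) with \<open>l\<^sup>2\<^sup>m = 2\<close> the function \<open>l\<^sup>-\<^sup>2\<^sup>N\<close> then satisfies the
  triangle inequality for three steps up to the factor 2, and Frink's metrization lemma gives a metric \<open>D\<close> between
  \<open>l\<^sup>-\<^sup>2\<^sup>N / 2\<close> and \<open>l\<^sup>-\<^sup>2\<^sup>N\<close>.

  The passage to \<open>D\<close> spoils the exact scaling. It is restored by
  \<open>d x y = sup\<^sub>k D (f\<^sup>k x) (f\<^sup>k y) / l\<^bsup>\<bar>k\<bar>\<^esup>\<close>: replacing \<open>(x, y)\<close> by its images under \<open>f\<close> and \<open>f\<^sup>-\<^sup>1\<close>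
  shifts the index, so the larger of the two suprema is \<open>l\<close> times the supremum for \<open>(x, y)\<close>, unless
  the latter is dominated by the term \<open>k = 0\<close> (\<open>sup_metric_self_similar\<close>). That does not happen
  for close points, because \<open>D\<close> decays at the rate \<open>l\<^sup>2\<close> while the weights decay only at the rate \<open>l\<close>:
  the term \<open>\<bar>k\<bar> = N x y\<close> is at least \<open>l\<^sup>-\<^sup>N / 2\<close>, the term \<open>k = 0\<close> at most \<open>l\<^sup>-\<^sup>2\<^sup>N\<close>. The same
  comparison gives \<open>l\<^sup>-\<^sup>N / 2 \<le> d x y \<le> l\<^sup>-\<^sup>N\<close>, and the topology of \<open>d\<close> is the original one since \<open>N\<close>
  is large exactly for close points.
\<close>

section \<open>Frink's metrization lemma\<close>

text \<open>In \<open>chain M g n x y s\<close> the number \<open>s\<close> is the length, measured by \<open>g\<close>, of a path of \<open>n\<close> steps from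
  \<open>x\<close> to \<open>y\<close> inside \<open>M\<close>. The steps are counted for the sake of the induction in
  \<open>chain_lower_bound\<close>.\<close>

inductive chain :: "'a set \<Rightarrow> ('a \<Rightarrow> 'a \<Rightarrow> real) \<Rightarrow> nat \<Rightarrow> 'a \<Rightarrow> 'a \<Rightarrow> real \<Rightarrow> bool"
  for M g where
    chain_refl: "x \<in> M \<Longrightarrow> chain M g 0 x x 0"
  | chain_snoc: "chain M g n x y s \<Longrightarrow> z \<in> M \<Longrightarrow> chain M g (Suc n) x z (s + g y z)"

lemma chain_endpoints: "chain M g n x y s \<Longrightarrow> x \<in> M \<and> y \<in> M"
  by (induction rule: chain.induct) auto

lemma chain_single: "\<lbrakk>x \<in> M; y \<in> M\<rbrakk> \<Longrightarrow> chain M g 1 x y (g x y)"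
  using chain_snoc[OF chain_refl] by fastforce

lemma chain_append:
  assumes "chain M g n x y s" and "chain M g k y z t"
  shows "chain M g (n + k) x z (s + t)"
  using assms(2,1)
proof (induction rule: chain.induct)
  case (chain_snoc k y z t w)
  then show ?case
    using chain.chain_snoc[of M g "n + k" x z "s + t" w] by (simp add: add.assoc)
qed simp

text \<open>The relaxed triangle inequality is required for three steps, not two, because
  \<open>chain_split\<close> cuts a path into three pieces.\<close>

locale quasi_metric =
  fixes M :: "'a set" and g :: "'a \<Rightarrow> 'a \<Rightarrow> real"
  assumes nonneg: "\<lbrakk>x \<in> M; y \<in> M\<rbrakk> \<Longrightarrow> 0 \<le> g x y"
    and sym: "\<lbrakk>x \<in> M; y \<in> M\<rbrakk> \<Longrightarrow> g x y = g y x"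
    and zero: "\<lbrakk>x \<in> M; y \<in> M\<rbrakk> \<Longrightarrow> g x y = 0 \<longleftrightarrow> x = y"
    and quasi: "\<lbrakk>w \<in> M; x \<in> M; y \<in> M; z \<in> M\<rbrakk> \<Longrightarrow>
                  g w z \<le> 2 * max (g w x) (max (g x y) (g y z))"
begin

lemma chain_nonneg: "chain M g n x y s \<Longrightarrow> 0 \<le> s"
  by (induction rule: chain.induct) (auto dest: chain_endpoints intro!: add_nonneg_nonneg nonneg)

lemma chain_reverse:
  "chain M g n x y s \<Longrightarrow> chain M g n y x s"
proof (induction rule: chain.induct)
  case (chain_snoc n x y s z)
  have "y \<in> M"
    using chain_endpoints[OF chain_snoc.hyps(1)] by simp
  then have "chain M g (1 + n) z x (g z y + s)"
    by (rule chain_append[OF chain_single[OF chain_snoc.hyps(2)] chain_snoc.IH])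
  then show ?case
    using sym[OF \<open>y \<in> M\<close> chain_snoc.hyps(2)] by (simp add: add.commute)
qed (rule chain_refl)

text \<open>The step from \<open>a\<close> to \<open>b\<close> is the one at which the accumulated length first exceeds \<open>t\<close> (or the
  last step, if that never happens).\<close>

lemma chain_split:
  assumes "chain M g n x y s" "0 < n" "0 \<le> t" "t \<le> s"
  shows "\<exists>i j a b u v. chain M g i x a u \<and> chain M g j b y v \<and> i < n \<and> j < n \<and>
           u \<le> t \<and> v \<le> s - t \<and> g a b \<le> s"
  using assms
proof (induction rule: chain.induct)
  case (chain_snoc n x y s z)
  have M: "y \<in> M" "z \<in> M"
    using chain_endpoints[OF chain_snoc.hyps(1)] chain_snoc.hyps(2) by auto
  have s: "0 \<le> s" "0 \<le> g y z"
    using chain_nonneg[OF chain_snoc.hyps(1)] nonneg[OF M] by auto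
  show ?case
  proof (cases "s \<le> t")
    case True
    have "s \<le> t" "0 \<le> s + g y z - t" "g y z \<le> s + g y z"
      using True s chain_snoc.prems by auto
    moreover have "chain M g 0 z z 0"
      using M by (intro chain_refl)
    ultimately show ?thesis
      using chain_snoc.hyps(1) by blast
  next
    case False
    have "0 < n"
    proof (rule ccontr)
      assume "\<not> 0 < n"
      with chain_snoc.hyps(1) have "s = 0"
        by (auto elim: chain.cases)
      with False chain_snoc.prems show False by simp
    qed
    have "t \<le> s" using False by simp
    from chain_snoc.IH[OF \<open>0 < n\<close> chain_snoc.prems(2) this]
    obtain i j a b u v where
      "chain M g i x a u" "chain M g j b y v" "i < n" "j < n" "u \<le> t" "v \<le> s - t" "g a b \<le> s"
      by blast
    moreover from this M have "chain M g (Suc j) b z (v + g y z)"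
      by (intro chain.chain_snoc)
    moreover have "v + g y z \<le> s + g y z - t" "g a b \<le> s + g y z"
      using \<open>v \<le> s - t\<close> \<open>g a b \<le> s\<close> s by auto
    ultimately show ?thesis
      by (intro exI[of _ i] exI[of _ "Suc j"] exI[of _ a] exI[of _ b] exI[of _ u]
          exI[of _ "v + g y z"] conjI) simp_all
  qed
qed simp

text \<open>Cutting at half the length \<open>s\<close>, the induction hypothesis bounds \<open>g\<close> between the ends of each outer
  piece by \<open>2 * (s / 2) = s\<close>, and the middle step is itself at most \<open>s\<close>; so the constant 2 of the
  relaxed triangle inequality is lost only once.\<close>

lemma chain_lower_bound: "chain M g n x y s \<Longrightarrow> g x y \<le> 2 * s"
proof (induction n arbitrary: x y s rule: less_induct)
  case (less n)
  have M: "x \<in> M" "y \<in> M"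
    using chain_endpoints[OF less.prems] by auto
  have s: "0 \<le> s"
    by (rule chain_nonneg[OF less.prems])
  show ?case
  proof (cases "n = 0")
    case True
    with less.prems have "x = y"
      by (auto elim: chain.cases)
    then show ?thesis
      using zero[OF M] s by simp
  next
    case False
    then have "0 < n" by simp
    from chain_split[OF less.prems this, of "s / 2"] s
    obtain i j a b u v where
      c: "chain M g i x a u" "chain M g j b y v" and "i < n" "j < n"
      and le: "u \<le> s / 2" "v \<le> s - s / 2" "g a b \<le> s"
      by auto
    then have "g x a \<le> 2 * u" "g b y \<le> 2 * v"
      by (auto intro: less.IH)
    then have "max (g x a) (max (g a b) (g b y)) \<le> s"
      using le by auto
    moreover have "g x y \<le> 2 * max (g x a) (max (g a b) (g b y))"
      using c M by (intro quasi) (auto dest: chain_endpoints)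
    ultimately show ?thesis by linarith
  qed
qed

text \<open>The metric is the infimum of the lengths of all chains; \<open>chain_lower_bound\<close> keeps it from
  collapsing.\<close>

theorem Frink_metrization:
  obtains D where "Metric_space M D"
    and "\<And>x y. \<lbrakk>x \<in> M; y \<in> M\<rbrakk> \<Longrightarrow> g x y / 2 \<le> D x y"
    and "\<And>x y. \<lbrakk>x \<in> M; y \<in> M\<rbrakk> \<Longrightarrow> D x y \<le> g x y"
proof -
  define L where "L x y = {s. \<exists>n. chain M g n x y s}" for x y
  \<comment> \<open>The locale \<open>Metric_space\<close> wants symmetry and nonnegativity outside of \<open>M\<close> too, hence the 0.\<close>
  define D where "D x y = (if x \<in> M \<and> y \<in> M then Inf (L x y) else 0)" for x y
  have L_nonneg: "0 \<le> s" if "s \<in> L x y" for s x y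
    using that by (auto simp: L_def intro: chain_nonneg)
  then have bdd: "bdd_below (L x y)" for x y
    by (intro bdd_belowI[of _ 0]) blast
  have L_single: "g x y \<in> L x y" if "x \<in> M" "y \<in> M" for x y
    using chain_single[OF that, of g] unfolding L_def by blast
  have upper: "D x y \<le> g x y" if "x \<in> M" "y \<in> M" for x y
    using cInf_lower[OF L_single[OF that] bdd] that by (simp add: D_def)
  have lower: "g x y / 2 \<le> D x y" if M: "x \<in> M" "y \<in> M" for x y
  proof -
    have "g x y / 2 \<le> s" if "s \<in> L x y" for s
      using that chain_lower_bound unfolding L_def by fastforce
    then have "g x y / 2 \<le> Inf (L x y)"
      using L_single[OF M] by (intro cInf_greatest) auto
    then show ?thesis using M by (simp add: D_def)
  qed
  have "Metric_space M D"
  proof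
    show "0 \<le> D x y" for x y
      using lower[of x y] nonneg[of x y] by (cases "x \<in> M \<and> y \<in> M") (auto simp: D_def)
    have "L x y = L y x" for x y
      using chain_reverse unfolding L_def by blast
    then show "D x y = D y x" for x y
      by (simp add: D_def)
    show "D x y = 0 \<longleftrightarrow> x = y" if "x \<in> M" "y \<in> M" for x y
      using lower[OF that] upper[OF that] zero[OF that] nonneg[OF that] by auto
    show "D x z \<le> D x y + D y z" if M: "x \<in> M" "y \<in> M" "z \<in> M" for x y z
    proof -
      have "Inf (L x z) - t \<le> s" if "s \<in> L x y" "t \<in> L y z" for s t
      proof -
        have "s + t \<in> L x z"
          using that unfolding L_def by (auto intro: chain_append)
        then show ?thesis
          using cInf_lower[OF _ bdd] by (simp add: diff_le_eq)
      qed
      then have "Inf (L x z) - t \<le> Inf (L x y)" if "t \<in> L y z" for t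
        using L_single[of x y] M that by (intro cInf_greatest) auto
      then have "Inf (L x z) - Inf (L x y) \<le> Inf (L y z)"
        using L_single[of y z] M by (intro cInf_greatest) (auto simp: algebra_simps)
      then show ?thesis
        using M by (simp add: D_def)
    qed
  qed
  from that[OF this lower upper] show thesis .
qed

end

section \<open>Iterates of a bijection and the weighted supremum metric\<close>

locale bijection_system =
  fixes M :: "'a set" and f :: "'a \<Rightarrow> 'a"
  assumes bij: "bij_betw f M M"
begin

abbreviation F :: "int \<Rightarrow> 'a \<Rightarrow> 'a" where
  "F \<equiv> int_iterate M f"

lemma inv_mem: "x \<in> M \<Longrightarrow> inv_into M f x \<in> M"
  using bij by (metis bij_betw_imp_surj_on inv_into_into)

lemma f_mem: "x \<in> M \<Longrightarrow> f x \<in> M"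
  using bij by (rule bij_betw_apply)

lemma F_mem: "x \<in> M \<Longrightarrow> F k x \<in> M"
proof -
  assume x: "x \<in> M"
  have "(f ^^ n) x \<in> M" "(inv_into M f ^^ n) x \<in> M" for n
    by (induction n) (auto simp: x f_mem inv_mem)
  then show ?thesis by (simp add: int_iterate_def)
qed

lemma F_0 [simp]: "F 0 x = x" and F_1 [simp]: "F 1 x = f x" and F_minus_1 [simp]: "F (-1) x = inv_into M f x"
  by (simp_all add: int_iterate_def)

lemma F_succ:
  assumes "x \<in> M" shows "F (k + 1) x = f (F k x)"
proof (cases "0 \<le> k")
  case True
  then show ?thesis by (simp add: int_iterate_def nat_add_distrib)
next
  case False
  then have "nat (- k) = Suc (nat (- (k + 1)))" by linarith
  then have "F k x = inv_into M f (F (k + 1) x)"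
    using False by (auto simp: int_iterate_def)
  then show ?thesis
    using F_mem[OF assms, of "k + 1"] bij by (simp add: bij_betw_inv_into_right)
qed

lemma F_pred: "x \<in> M \<Longrightarrow> F (k - 1) x = inv_into M f (F k x)"
  using F_succ[of x "k - 1"] F_mem[of x "k - 1"] bij by (simp add: bij_betw_inv_into_left)

lemma F_add: "x \<in> M \<Longrightarrow> F (j + k) x = F j (F k x)"
proof (induction j rule: int_induct[of _ 0])
  case (step1 j)
  then show ?case
    using F_succ[of x "j + k"] F_succ[of "F k x" j] F_mem by (simp add: add.commute add.left_commute)
next
  case (step2 j)
  then show ?case
    using F_pred[of x "j + k"] F_pred[of "F k x" j] F_mem by (simp add: algebra_simps)
qed simp

lemma F_inj: "\<lbrakk>x \<in> M; y \<in> M\<rbrakk> \<Longrightarrow> F k x = F k y \<longleftrightarrow> x = y"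
  using F_add[of x "-k" k] F_add[of y "-k" k] by auto

text \<open>The weights are chosen so that a shift of the index by one costs at most a factor \<open>l\<close>. Outside
  of \<open>M\<close> the value is 0, as the locale \<open>Metric_space\<close> wants symmetry and nonnegativity everywhere.\<close>

definition sup_metric :: "real \<Rightarrow> ('a \<Rightarrow> 'a \<Rightarrow> real) \<Rightarrow> 'a \<Rightarrow> 'a \<Rightarrow> real" where
  "sup_metric l D x y =
     (if x \<in> M \<and> y \<in> M then SUP k. D (F k x) (F k y) / l ^ nat \<bar>k\<bar> else 0)"

lemma sup_metric_le:
  assumes "x \<in> M" "y \<in> M" "\<And>k. D (F k x) (F k y) / l ^ nat \<bar>k\<bar> \<le> c"
  shows "sup_metric l D x y \<le> c"
  using assms by (simp add: sup_metric_def cSUP_least)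

context
  fixes D :: "'a \<Rightarrow> 'a \<Rightarrow> real" and l :: real
  assumes D: "Metric_space M D" and bounded: "\<And>x y. \<lbrakk>x \<in> M; y \<in> M\<rbrakk> \<Longrightarrow> D x y \<le> 1"
    and l: "1 < l"
begin

interpretation D: Metric_space M D by (rule D)

lemma sup_metric_term_le:
  assumes "x \<in> M" "y \<in> M"
  shows "D (F k x) (F k y) / l ^ nat \<bar>k\<bar> \<le> sup_metric l D x y"
proof -
  have "D (F j x) (F j y) / l ^ nat \<bar>j\<bar> \<le> 1" for j
    using order_trans[OF bounded[OF F_mem F_mem, OF assms, of j j] one_le_power[of l "nat \<bar>j\<bar>"]] l
    by (simp add: divide_le_eq)
  then have "bdd_above (range (\<lambda>j. D (F j x) (F j y) / l ^ nat \<bar>j\<bar>))"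
    by (intro bdd_aboveI[of _ 1]) auto
  from cSUP_upper[OF UNIV_I this] show ?thesis
    using assms by (simp add: sup_metric_def)
qed

lemma Metric_space_sup_metric: "Metric_space M (sup_metric l D)"
proof
  have ge: "D x y \<le> sup_metric l D x y" if "x \<in> M" "y \<in> M" for x y
    using sup_metric_term_le[OF that, of 0] by simp
  show nonneg: "0 \<le> sup_metric l D x y" for x y
    using order_trans[OF D.nonneg ge] by (cases "x \<in> M \<and> y \<in> M") (auto simp: sup_metric_def)
  show "sup_metric l D x y = sup_metric l D y x" for x y
    by (simp add: sup_metric_def D.commute)
  show "sup_metric l D x y = 0 \<longleftrightarrow> x = y" if M: "x \<in> M" "y \<in> M" for x y
  proof
    assume "sup_metric l D x y = 0"
    then show "x = y"
      using ge[OF M] D.nonneg[of x y] D.zero[OF M] by linarith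
  next
    assume "x = y"
    then have "sup_metric l D x y \<le> 0"
      using M by (intro sup_metric_le) (auto simp: F_mem)
    then show "sup_metric l D x y = 0"
      using nonneg[of x y] by linarith
  qed
  show "sup_metric l D x z \<le> sup_metric l D x y + sup_metric l D y z"
    if M: "x \<in> M" "y \<in> M" "z \<in> M" for x y z
  proof (rule sup_metric_le)
    fix k
    have "D (F k x) (F k z) / l ^ nat \<bar>k\<bar> \<le>
        D (F k x) (F k y) / l ^ nat \<bar>k\<bar> + D (F k y) (F k z) / l ^ nat \<bar>k\<bar>"
      using D.triangle[of "F k x" "F k y" "F k z"] M F_mem l
      by (simp flip: add_divide_distrib add: divide_right_mono)
    also have "\<dots> \<le> sup_metric l D x y + sup_metric l D y z"
      using M by (intro add_mono sup_metric_term_le)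
    finally show "D (F k x) (F k z) / l ^ nat \<bar>k\<bar> \<le> \<dots>" .
  qed (use M in auto)
qed

lemma sup_metric_F_le:
  assumes M: "x \<in> M" "y \<in> M" and j: "\<bar>j\<bar> = 1"
  shows "sup_metric l D (F j x) (F j y) \<le> l * sup_metric l D x y"
proof (rule sup_metric_le)
  fix k
  have "nat \<bar>k + j\<bar> \<le> Suc (nat \<bar>k\<bar>)"
    using j by linarith
  then have "l ^ nat \<bar>k + j\<bar> \<le> l * l ^ nat \<bar>k\<bar>"
    using l power_increasing[of "nat \<bar>k + j\<bar>" "Suc (nat \<bar>k\<bar>)" l] by simp
  moreover have "D (F (k + j) x) (F (k + j) y) \<le> sup_metric l D x y * l ^ nat \<bar>k + j\<bar>"
    using sup_metric_term_le[OF M, of "k + j"] l by (simp add: divide_le_eq)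
  moreover have "0 \<le> sup_metric l D x y"
    using sup_metric_term_le[OF M, of 0] D.nonneg[of x y] by (simp del: D.nonneg)
  ultimately have "D (F (k + j) x) (F (k + j) y) \<le> sup_metric l D x y * (l * l ^ nat \<bar>k\<bar>)"
    by (meson mult_left_mono order_trans)
  then show "D (F k (F j x)) (F k (F j y)) / l ^ nat \<bar>k\<bar> \<le> l * sup_metric l D x y"
    using l M by (simp add: divide_le_eq mult_ac flip: F_add)
qed (use M F_mem in auto)

text \<open>The hypothesis on \<open>k\<close> says that \<open>j\<close> and \<open>k\<close> point in the same direction. Then the term \<open>k\<close> for
  \<open>(x, y)\<close> reappears as the term \<open>k - j\<close> for the shifted pair, with a weight larger by the factor
  \<open>l\<close>.\<close>

lemma sup_metric_term_scaled:
  assumes M: "x \<in> M" "y \<in> M" and j: "\<bar>j\<bar> = 1" and k: "\<bar>k\<bar> = \<bar>k - j\<bar> + 1"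
  shows "l * (D (F k x) (F k y) / l ^ nat \<bar>k\<bar>) \<le> sup_metric l D (F j x) (F j y)"
proof -
  have "nat \<bar>k\<bar> = Suc (nat \<bar>k - j\<bar>)"
    using k by linarith
  then have "l * (D (F k x) (F k y) / l ^ nat \<bar>k\<bar>) = D (F k x) (F k y) / l ^ nat \<bar>k - j\<bar>"
    using l by simp
  also have "\<dots> \<le> sup_metric l D (F j x) (F j y)"
    using sup_metric_term_le[OF F_mem[OF M(1)] F_mem[OF M(2)], of "k - j" j j]
    by (simp flip: F_add[OF M(1)] F_add[OF M(2)])
  finally show ?thesis .
qed

text \<open>Each term with \<open>k \<noteq> 0\<close> gains the full factor \<open>l\<close> under \<open>f\<close> (if \<open>k > 0\<close>) or under the inverse of
  \<open>f\<close> (if \<open>k < 0\<close>). Only the term \<open>k = 0\<close> loses in both directions, so it must not be the one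
  that determines the supremum.\<close>

lemma sup_metric_self_similar:
  assumes M: "x \<in> M" "y \<in> M" and k: "k \<noteq> 0" "D x y \<le> D (F k x) (F k y) / l ^ nat \<bar>k\<bar>"
  shows "max (sup_metric l D (f x) (f y)) (sup_metric l D (inv_into M f x) (inv_into M f y)) =
         l * sup_metric l D x y"
    (is "?m = _")
proof (rule antisym)
  show "?m \<le> l * sup_metric l D x y"
    using sup_metric_F_le[OF M, of 1] sup_metric_F_le[OF M, of "-1"] by simp
  have nz: "D (F j x) (F j y) / l ^ nat \<bar>j\<bar> \<le> ?m / l" if "j \<noteq> 0" for j
  proof -
    have "l * (D (F j x) (F j y) / l ^ nat \<bar>j\<bar>) \<le> ?m"
    proof (cases "0 < j")
      case True
      then show ?thesis
        using sup_metric_term_scaled[OF M, of 1 j] by simp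
    next
      case False
      with that show ?thesis
        using sup_metric_term_scaled[OF M, of "-1" j] by simp
    qed
    then show ?thesis
      using l by (simp add: pos_le_divide_eq mult.commute)
  qed
  have "sup_metric l D x y \<le> ?m / l"
  proof (rule sup_metric_le[OF M])
    fix j
    show "D (F j x) (F j y) / l ^ nat \<bar>j\<bar> \<le> ?m / l"
      using nz[of j] order_trans[OF k(2) nz[OF k(1)]] by (cases "j = 0") auto
  qed
  then show "l * sup_metric l D x y \<le> ?m"
    using l by (simp add: pos_le_divide_eq mult.commute)
qed

end

end

section \<open>Separation times\<close>

text \<open>The constant \<open>\<eta> / 3\<close> is what one of three consecutive distances must reach if the distance
  between the endpoints exceeds \<open>\<eta>\<close>.\<close>

locale uniformly_expansive = Metric_space M \<rho> + bijection_system M f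
  for M :: "'a set" and \<rho> :: "'a \<Rightarrow> 'a \<Rightarrow> real" and f :: "'a \<Rightarrow> 'a" +
  fixes \<eta> :: real and m :: nat
  assumes separated: "\<lbrakk>x \<in> M; y \<in> M; x \<noteq> y\<rbrakk> \<Longrightarrow> \<exists>k. \<eta> < \<rho> (F k x) (F k y)"
    and eta_pos: "0 < \<eta>"
    and m_pos: "0 < m"
    and separated_soon:
      "\<lbrakk>x \<in> M; y \<in> M; \<eta> / 3 \<le> \<rho> x y\<rbrakk> \<Longrightarrow> \<exists>k. nat \<bar>k\<bar> \<le> m \<and> \<eta> < \<rho> (F k x) (F k y)"
begin

definition sep_time :: "'a \<Rightarrow> 'a \<Rightarrow> nat" where
  "sep_time x y = (LEAST n. \<exists>k. nat \<bar>k\<bar> = n \<and> \<eta> < \<rho> (F k x) (F k y))"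

lemma sep_time_le: "\<eta> < \<rho> (F k x) (F k y) \<Longrightarrow> sep_time x y \<le> nat \<bar>k\<bar>"
  unfolding sep_time_def by (intro Least_le) auto

lemma sep_time_attained:
  assumes "x \<in> M" "y \<in> M" "x \<noteq> y"
  obtains k where "nat \<bar>k\<bar> = sep_time x y" "\<eta> < \<rho> (F k x) (F k y)"
proof -
  have "\<exists>k. nat \<bar>k\<bar> = sep_time x y \<and> \<eta> < \<rho> (F k x) (F k y)"
    unfolding sep_time_def by (rule LeastI_ex) (use separated[OF assms] in auto)
  then show thesis using that by blast
qed

lemma sep_time_commute: "sep_time x y = sep_time y x"
  by (simp add: sep_time_def commute)

lemma sep_time_shift:
  assumes "x \<in> M" "y \<in> M" "x \<noteq> y"
  shows "sep_time x y \<le> sep_time (F k x) (F k y) + nat \<bar>k\<bar>"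
proof -
  obtain j where j: "nat \<bar>j\<bar> = sep_time (F k x) (F k y)" "\<eta> < \<rho> (F j (F k x)) (F j (F k y))"
    using sep_time_attained[of "F k x" "F k y"] assms by (metis F_inj F_mem)
  then have "sep_time x y \<le> nat \<bar>j + k\<bar>"
    using assms by (intro sep_time_le) (simp add: F_add)
  then show ?thesis using j by linarith
qed

text \<open>At the time \<open>k\<close> when \<open>w\<close> and \<open>z\<close> are separated, one of the three intermediate pairs is at least
  \<open>\<eta> / 3\<close> apart, and so separates at most \<open>m\<close> time steps from \<open>k\<close>.\<close>

lemma sep_time_triangle3:
  assumes M: "w \<in> M" "x \<in> M" "y \<in> M" "z \<in> M" and "w \<noteq> z"
  obtains a b where "(a, b) \<in> {(w, x), (x, y), (y, z)}" "a \<noteq> b" "sep_time a b \<le> sep_time w z + m"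
proof -
  obtain k where k: "nat \<bar>k\<bar> = sep_time w z" "\<eta> < \<rho> (F k w) (F k z)"
    using sep_time_attained[OF M(1,4) \<open>w \<noteq> z\<close>] by blast
  have "\<rho> (F k w) (F k z) \<le> \<rho> (F k w) (F k x) + \<rho> (F k x) (F k z)"
    "\<rho> (F k x) (F k z) \<le> \<rho> (F k x) (F k y) + \<rho> (F k y) (F k z)"
    using M F_mem by (auto intro: triangle)
  then have "\<eta> / 3 \<le> \<rho> (F k w) (F k x) \<or> \<eta> / 3 \<le> \<rho> (F k x) (F k y) \<or> \<eta> / 3 \<le> \<rho> (F k y) (F k z)"
    using k(2) by linarith
  then obtain a b where ab: "(a, b) \<in> {(w, x), (x, y), (y, z)}" "\<eta> / 3 \<le> \<rho> (F k a) (F k b)"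
    by auto
  then have M': "a \<in> M" "b \<in> M"
    using M by auto
  then obtain j where j: "nat \<bar>j\<bar> \<le> m" "\<eta> < \<rho> (F j (F k a)) (F j (F k b))"
    using separated_soon[of "F k a" "F k b"] ab(2) F_mem by blast
  then have "sep_time a b \<le> nat \<bar>j + k\<bar>"
    using M' by (intro sep_time_le) (simp add: F_add)
  then have "sep_time a b \<le> sep_time w z + m"
    using j(1) k(1) by linarith
  moreover have "a \<noteq> b"
    using ab(2) eta_pos M' F_mem by auto
  ultimately show thesis
    using ab(1) that by blast
qed

text \<open>The base for which \<open>m\<close> units of separation time correspond to the factor 2 in \<open>sep_dist\<close>. It is
  also the factor of the self-similar metric.\<close>

definition growth :: real where
  "growth = root (2 * m) 2"

lemma growth_gt_1: "1 < growth"
  using m_pos by (simp add: growth_def)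

lemma growth_power: "growth ^ (2 * m) = 2"
  using m_pos by (simp add: growth_def)

text \<open>The exponent carries a factor 2 so that \<open>sep_dist\<close> decays strictly faster than the weights
  \<open>1 / growth ^ nat \<bar>k\<bar>\<close> in \<open>sup_metric\<close>.\<close>

definition sep_dist :: "'a \<Rightarrow> 'a \<Rightarrow> real" where
  "sep_dist x y = (if x = y then 0 else 1 / growth ^ (2 * sep_time x y))"

lemma sep_dist_le_1: "sep_dist x y \<le> 1"
  using growth_gt_1 by (simp add: sep_dist_def)

sublocale sep: quasi_metric M sep_dist
proof
  show "sep_dist w z \<le> 2 * max (sep_dist w x) (max (sep_dist x y) (sep_dist y z))"
    if M: "w \<in> M" "x \<in> M" "y \<in> M" "z \<in> M" for w x y z
  proof (cases "w = z")
    case True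
    then show ?thesis
      using growth_gt_1 by (simp add: sep_dist_def le_max_iff_disj)
  next
    case False
    then obtain a b where ab: "(a, b) \<in> {(w, x), (x, y), (y, z)}" "a \<noteq> b"
      and le: "sep_time a b \<le> sep_time w z + m"
      using sep_time_triangle3[OF M] by blast
    have "growth ^ (2 * sep_time a b) \<le> growth ^ (2 * sep_time w z + 2 * m)"
      using le growth_gt_1 by (intro power_increasing) auto
    also have "\<dots> = 2 * growth ^ (2 * sep_time w z)"
      by (simp add: power_add growth_power)
    finally have "sep_dist w z \<le> 2 * sep_dist a b"
      using growth_gt_1 False ab(2) by (simp add: sep_dist_def field_simps)
    also have "\<dots> \<le> 2 * max (sep_dist w x) (max (sep_dist x y) (sep_dist y z))"
      using ab(1) by auto
    finally show ?thesis .
  qed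
qed (use growth_gt_1 in \<open>auto simp: sep_dist_def sep_time_commute\<close>)

text \<open>The two-sided bound by powers of \<open>growth\<close> is part of the conclusion because it determines the
  topology of \<open>d\<close>.\<close>

theorem self_similar_metric:
  obtains d where "Metric_space M d"
    and "\<And>x y. \<lbrakk>x \<in> M; y \<in> M; x \<noteq> y\<rbrakk> \<Longrightarrow> 1 / (2 * growth ^ sep_time x y) \<le> d x y"
    and "\<And>x y. \<lbrakk>x \<in> M; y \<in> M; x \<noteq> y\<rbrakk> \<Longrightarrow> d x y \<le> 1 / growth ^ sep_time x y"
    and "\<And>x y. \<lbrakk>x \<in> M; y \<in> M; d x y \<le> 1 / 4\<rbrakk> \<Longrightarrow>
           max (d (f x) (f y)) (d (inv_into M f x) (inv_into M f y)) = growth * d x y"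
proof -
  obtain D where D: "Metric_space M D"
    and D_ge: "\<And>x y. \<lbrakk>x \<in> M; y \<in> M\<rbrakk> \<Longrightarrow> sep_dist x y / 2 \<le> D x y"
    and D_le: "\<And>x y. \<lbrakk>x \<in> M; y \<in> M\<rbrakk> \<Longrightarrow> D x y \<le> sep_dist x y"
    using sep.Frink_metrization by blast
  have D_le_1: "D x y \<le> 1" if "x \<in> M" "y \<in> M" for x y
    using D_le[OF that] sep_dist_le_1[of x y] by linarith
  define d where "d = sup_metric growth D"
  note term_le = sup_metric_term_le[OF D D_le_1 growth_gt_1, folded d_def]
  have peak: "\<exists>k. nat \<bar>k\<bar> = sep_time x y \<and> 1 / 2 \<le> D (F k x) (F k y)"
    if M: "x \<in> M" "y \<in> M" "x \<noteq> y" for x y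
  proof -
    obtain k where k: "nat \<bar>k\<bar> = sep_time x y" "\<eta> < \<rho> (F k x) (F k y)"
      using sep_time_attained[OF M] by blast
    have "sep_time (F k x) (F k y) = 0"
      using sep_time_le[of 0 "F k x" "F k y"] k(2) by simp
    then have "sep_dist (F k x) (F k y) = 1"
      using M by (simp add: sep_dist_def F_inj)
    then show ?thesis
      using D_ge[of "F k x" "F k y"] M F_mem k(1) by auto
  qed
  \<comment> \<open>The term at the moment of separation bounds the supremum from below.\<close>
  have lower: "1 / (2 * growth ^ sep_time x y) \<le> d x y" if M: "x \<in> M" "y \<in> M" "x \<noteq> y" for x y
  proof -
    obtain k where k: "nat \<bar>k\<bar> = sep_time x y" "1 / 2 \<le> D (F k x) (F k y)"
      using peak[OF M] by blast
    have "(1 / 2) / growth ^ sep_time x y \<le> D (F k x) (F k y) / growth ^ sep_time x y"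
      using k(2) growth_gt_1 by (intro divide_right_mono) auto
    also have "\<dots> = D (F k x) (F k y) / growth ^ nat \<bar>k\<bar>"
      by (simp add: k(1))
    also have "\<dots> \<le> d x y"
      using M by (intro term_le)
    finally show ?thesis by simp
  qed
  have upper: "d x y \<le> 1 / growth ^ sep_time x y" if M: "x \<in> M" "y \<in> M" "x \<noteq> y" for x y
    unfolding d_def
  proof (rule sup_metric_le[OF M(1,2)])
    fix k
    \<comment> \<open>By \<open>sep_time_shift\<close> the exponent \<open>2 * ?n + \<bar>k\<bar>\<close> of the term \<open>k\<close> is at least \<open>sep_time x y\<close>.\<close>
    let ?n = "sep_time (F k x) (F k y)"
    have "D (F k x) (F k y) / growth ^ nat \<bar>k\<bar> \<le> sep_dist (F k x) (F k y) / growth ^ nat \<bar>k\<bar>"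
      using growth_gt_1 M F_mem by (intro divide_right_mono D_le) auto
    also have "\<dots> = 1 / growth ^ (2 * ?n + nat \<bar>k\<bar>)"
      using M by (simp add: sep_dist_def F_inj power_add)
    also have "\<dots> \<le> 1 / growth ^ sep_time x y"
      using growth_gt_1 sep_time_shift[OF M, of k]
      by (intro divide_left_mono power_increasing) auto
    finally show "D (F k x) (F k y) / growth ^ nat \<bar>k\<bar> \<le> 1 / growth ^ sep_time x y" .
  qed
  have self_similar: "max (d (f x) (f y)) (d (inv_into M f x) (inv_into M f y)) = growth * d x y"
    if M: "x \<in> M" "y \<in> M" and small: "d x y \<le> 1 / 4" for x y
  proof (cases "x = y")
    case True
    interpret d: Metric_space M d
      unfolding d_def by (rule Metric_space_sup_metric[OF D D_le_1 growth_gt_1])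
    show ?thesis
      using True M by (simp add: f_mem inv_mem)
  next
    case False
    let ?n = "sep_time x y"
    obtain k where k: "nat \<bar>k\<bar> = ?n" "1 / 2 \<le> D (F k x) (F k y)"
      using peak[OF M False] by blast
    have "1 / (2 * growth ^ ?n) \<le> 1 / 4"
      using lower[OF M False] small by linarith
    \<comment> \<open>This is where the threshold \<open>1 / 4\<close> comes from; it also forces \<open>?n\<close>, hence \<open>k\<close>, to be nonzero.\<close>
    then have n: "2 \<le> growth ^ ?n"
      using growth_gt_1 by (simp add: field_simps)
    have "D x y \<le> 1 / (growth ^ ?n * growth ^ ?n)"
      using D_le[OF M] False by (simp add: sep_dist_def mult_2 power_add)
    also have "\<dots> \<le> (1 / 2) / growth ^ ?n"
      using n growth_gt_1 by (simp add: field_simps)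
    also have "\<dots> \<le> D (F k x) (F k y) / growth ^ ?n"
      using k(2) growth_gt_1 by (intro divide_right_mono) auto
    also have "\<dots> = D (F k x) (F k y) / growth ^ nat \<bar>k\<bar>"
      by (simp add: k(1))
    finally show ?thesis
      unfolding d_def
      using n k(1) by (intro sup_metric_self_similar[OF D D_le_1 growth_gt_1 M, of k]) auto
  qed
  show thesis
    using Metric_space_sup_metric[OF D D_le_1 growth_gt_1] lower upper self_similar
    by (intro that[of d]) (auto simp: d_def)
qed

end

section \<open>Compactness and continuity\<close>

lemma mtopology_eqI:
  assumes d: "Metric_space M d" and d': "Metric_space M d'"
    and le: "\<And>x e. \<lbrakk>x \<in> M; 0 < e\<rbrakk> \<Longrightarrow> \<exists>\<delta>>0. \<forall>y\<in>M. d x y < \<delta> \<longrightarrow> d' x y < e"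
    and ge: "\<And>x e. \<lbrakk>x \<in> M; 0 < e\<rbrakk> \<Longrightarrow> \<exists>\<delta>>0. \<forall>y\<in>M. d' x y < \<delta> \<longrightarrow> d x y < e"
  shows "Metric_space.mtopology M d = Metric_space.mtopology M d'"
proof -
  interpret D: Metric_space M d by (rule d)
  interpret D': Metric_space M d' by (rule d')
  have "continuous_map D.mtopology D'.mtopology id"
    using le by (subst D.metric_continuous_map[OF d']) (simp, meson)
  moreover have "continuous_map D'.mtopology D.mtopology id"
    using ge by (subst D'.metric_continuous_map[OF d]) (simp, meson)
  ultimately have "homeomorphic_maps D.mtopology D'.mtopology id id"
    by (simp add: homeomorphic_maps_def)
  then show ?thesis
    by (simp add: homeomorphic_maps_id)
qed

text \<open>The pairs at distance at least \<open>e\<close> form a compact subset of \<open>M \<times> M\<close> that misses the diagonal, so it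
  is covered by the open sets \<open>U k\<close> of the pairs separated at time \<open>k\<close>; finitely many of them
  suffice.\<close>

lemma (in Metric_space) uniform_separation:
  assumes cpt: "compact_space mtopology"
    and cont: "\<And>k::int. continuous_map mtopology mtopology (F k)"
    and sep: "\<And>x y. \<lbrakk>x \<in> M; y \<in> M; x \<noteq> y\<rbrakk> \<Longrightarrow> \<exists>k. \<eta> < d (F k x) (F k y)"
    and e: "0 < e"
  shows "\<exists>m. \<forall>x\<in>M. \<forall>y\<in>M. e \<le> d x y \<longrightarrow> (\<exists>k. nat \<bar>k\<bar> \<le> m \<and> \<eta> < d (F k x) (F k y))"
proof -
  let ?X = "prod_topology mtopology mtopology"
  define U where "U k = {p \<in> topspace ?X. d (F k (fst p)) (F k (snd p)) \<in> {\<eta><..}}" for k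
  define C where "C = {p \<in> topspace ?X. d (fst p) (snd p) \<in> {e..}}"
  have dist: "continuous_map ?X euclidean (\<lambda>p. d (h (fst p)) (h (snd p)))"
    if "continuous_map mtopology mtopology h" for h
    using continuous_map_mdist[of ?X "metric (M, d)" "h \<circ> fst" "h \<circ> snd"]
      continuous_map_compose[OF continuous_map_fst that, of mtopology]
      continuous_map_compose[OF continuous_map_snd that, of mtopology]
    by (simp add: o_def)
  have "openin ?X (U k)" for k
    unfolding U_def by (rule openin_continuous_map_preimage[OF dist[OF cont]]) auto
  moreover have "closedin ?X C"
    unfolding C_def using dist[of id] by (intro closedin_continuous_map_preimage) auto
  then have "compactin ?X C"
    using cpt by (intro closedin_compact_space) (auto simp: compact_space_prod_topology)
  moreover have "C \<subseteq> \<Union>(range U)"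
    using sep e by (fastforce simp: C_def U_def)
  ultimately obtain \<F> where "finite \<F>" "\<F> \<subseteq> range U" "C \<subseteq> \<Union>\<F>"
    using compactinD[of ?X C "range U"] by blast
  then obtain K where K: "finite K" "C \<subseteq> \<Union>(U ` K)"
    using finite_subset_image[of \<F> U UNIV] by blast
  define m where "m = Max (insert 0 ((\<lambda>k. nat \<bar>k\<bar>) ` K))"
  have m: "nat \<bar>k\<bar> \<le> m" if "k \<in> K" for k
    using K(1) that by (auto simp: m_def)
  have "\<exists>k. nat \<bar>k\<bar> \<le> m \<and> \<eta> < d (F k x) (F k y)" if "x \<in> M" "y \<in> M" "e \<le> d x y" for x y
  proof -
    have "(x, y) \<in> C"
      using that by (simp add: C_def)
    then obtain k where "k \<in> K" "(x, y) \<in> U k"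
      using K(2) by blast
    then show ?thesis
      using m by (auto simp: U_def)
  qed
  then show ?thesis by blast
qed

lemma (in bijection_system) continuous_F:
  assumes X: "topspace X = M" and f: "homeomorphic_map X X f"
  shows "continuous_map X X (F k)"
proof -
  have "homeomorphic_map X X (inv_into M f)"
  proof -
    obtain g where g: "homeomorphic_maps X X f g"
      using f homeomorphic_map_maps by blast
    have "inv_into M f x = g x" if "x \<in> M" for x
      using g that X bij
      by (metis bij_betw_inv_into_left homeomorphic_maps_map f_inv_into_f bij_betw_imp_surj_on inv_mem)
    moreover have "homeomorphic_map X X g"
      using g homeomorphic_maps_map by blast
    ultimately show ?thesis
      using X by (metis homeomorphic_map_eq)
  qed
  then have "continuous_map X X (f ^^ n)" "continuous_map X X (inv_into M f ^^ n)" for n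
    by (induction n)
      (auto simp: f homeomorphic_imp_continuous_map intro: continuous_map_compose)
  then show ?thesis
    by (simp add: int_iterate_def)
qed

section \<open>Existence of a self-similar metric\<close>

theorem theorem2p3:
  fixes M :: "'a set" and \<rho> :: "'a \<Rightarrow> 'a \<Rightarrow> real" and f :: "'a \<Rightarrow> 'a"
  assumes "Metric_space M \<rho>"
    and "compact_space (Metric_space.mtopology M \<rho>)"
    and "homeomorphic_map (Metric_space.mtopology M \<rho>) (Metric_space.mtopology M \<rho>) f"
    and "expansive M \<rho> f"
  shows "\<exists>(d :: 'a \<Rightarrow> 'a \<Rightarrow> real) (\<xi> :: real) (l :: real).
           Metric_space M d \<and>
           Metric_space.mtopology M d = Metric_space.mtopology M \<rho> \<and>
           \<xi> > 0 \<and> l > 1 \<and>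
           (\<forall>p\<in>M. \<forall>q\<in>M. d p q \<le> \<xi> \<longrightarrow>
              max (d (f p) (f q)) (d (inv_into M f p) (inv_into M f q)) = l * d p q)"
proof -
  interpret Metric_space M \<rho> by fact
  interpret bijection_system M f
    using assms(3) by unfold_locales (auto simp: bij_betw_def homeomorphic_eq_everything_map)
  obtain \<eta> where eta: "0 < \<eta>"
    and sep: "\<And>x y. \<lbrakk>x \<in> M; y \<in> M; x \<noteq> y\<rbrakk> \<Longrightarrow> \<exists>k. \<eta> < \<rho> (F k x) (F k y)"
    using assms(4) unfolding expansive_def by blast
  have cont: "continuous_map mtopology mtopology (F k)" for k
    by (rule continuous_F) (use assms(3) in auto)
  note unif = uniform_separation[OF assms(2) cont sep]
  obtain m where m: "\<forall>x\<in>M. \<forall>y\<in>M. \<eta> / 3 \<le> \<rho> x y \<longrightarrow>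
      (\<exists>k. nat \<bar>k\<bar> \<le> m \<and> \<eta> < \<rho> (F k x) (F k y))"
    using unif[of "\<eta> / 3"] eta by auto
  \<comment> \<open>\<open>Suc m\<close> in place of \<open>m\<close>, as the base \<open>growth\<close> is a root of positive order.\<close>
  interpret uniformly_expansive M \<rho> f \<eta> "Suc m"
  proof
    show "\<exists>k. nat \<bar>k\<bar> \<le> Suc m \<and> \<eta> < \<rho> (F k x) (F k y)"
      if "x \<in> M" "y \<in> M" "\<eta> / 3 \<le> \<rho> x y" for x y
      using m that le_SucI by blast
  qed (use eta sep in auto)
  obtain d where d: "Metric_space M d"
    and lower: "\<And>x y. \<lbrakk>x \<in> M; y \<in> M; x \<noteq> y\<rbrakk> \<Longrightarrow> 1 / (2 * growth ^ sep_time x y) \<le> d x y"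
    and upper: "\<And>x y. \<lbrakk>x \<in> M; y \<in> M; x \<noteq> y\<rbrakk> \<Longrightarrow> d x y \<le> 1 / growth ^ sep_time x y"
    and self_similar: "\<And>x y. \<lbrakk>x \<in> M; y \<in> M; d x y \<le> 1 / 4\<rbrakk> \<Longrightarrow>
           max (d (f x) (f y)) (d (inv_into M f x) (inv_into M f y)) = growth * d x y"
    using self_similar_metric by blast
  interpret d: Metric_space M d by (rule d)
  have "d.mtopology = mtopology"
  proof (rule mtopology_eqI[OF d assms(1)])
    \<comment> \<open>Points at distance \<open>e\<close> or more separate within a bounded time, hence are not \<open>d\<close>-close.\<close>
    fix x and e :: real
    assume x: "x \<in> M" and e: "0 < e"
    obtain n where n: "\<forall>x\<in>M. \<forall>y\<in>M. e \<le> \<rho> x y \<longrightarrow> (\<exists>k. nat \<bar>k\<bar> \<le> n \<and> \<eta> < \<rho> (F k x) (F k y))"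
      using unif[OF _ _ _ e] by auto
    have "\<rho> x y < e" if y: "y \<in> M" and small: "d x y < 1 / (2 * growth ^ n)" for y
    proof (rule ccontr)
      assume "\<not> \<rho> x y < e"
      then obtain k where "nat \<bar>k\<bar> \<le> n" "\<eta> < \<rho> (F k x) (F k y)" and "x \<noteq> y"
        using n x y e by force
      then have "sep_time x y \<le> n"
        using sep_time_le le_trans by blast
      then have "growth ^ sep_time x y \<le> growth ^ n"
        using growth_gt_1 by (intro power_increasing) auto
      then have "1 / (2 * growth ^ n) \<le> 1 / (2 * growth ^ sep_time x y)"
        using growth_gt_1 by (intro divide_left_mono) auto
      then show False
        using lower[OF x y \<open>x \<noteq> y\<close>] small by linarith
    qed
    then show "\<exists>\<delta>>0. \<forall>y\<in>M. d x y < \<delta> \<longrightarrow> \<rho> x y < e"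
      using growth_gt_1 by (intro exI[of _ "1 / (2 * growth ^ n)"]) auto
  next
    \<comment> \<open>By continuity, points near \<open>x\<close> are not separated from \<open>x\<close> by any given finite set of iterates.\<close>
    fix x and e :: real
    assume x: "x \<in> M" and e: "0 < e"
    obtain n where "1 / e < growth ^ n"
      using real_arch_pow[OF growth_gt_1] by blast
    then have n: "1 / growth ^ n < e"
      using e growth_gt_1 by (simp add: field_simps)
    define K where "K = {k::int. nat \<bar>k\<bar> \<le> n}"
    have K: "finite K"
      by (rule finite_subset[of _ "{- int n..int n}"]) (auto simp: K_def)
    have "\<forall>k. \<exists>\<delta>>0. \<forall>y. y \<in> M \<and> \<rho> x y < \<delta> \<longrightarrow> \<rho> (F k x) (F k y) < \<eta>"
      using cont x eta metric_continuous_map[OF assms(1)] by blast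
    then obtain \<delta> where \<delta>: "\<And>k. 0 < \<delta> k"
      "\<And>k y. \<lbrakk>y \<in> M; \<rho> x y < \<delta> k\<rbrakk> \<Longrightarrow> \<rho> (F k x) (F k y) < \<eta>"
      by metis
    have "d x y < e" if y: "y \<in> M" and close: "\<rho> x y < Min (insert 1 (\<delta> ` K))" for y
    proof (cases "x = y")
      case False
      have "n \<le> sep_time x y"
      proof (rule ccontr)
        assume "\<not> n \<le> sep_time x y"
        obtain k where k: "nat \<bar>k\<bar> = sep_time x y" "\<eta> < \<rho> (F k x) (F k y)"
          using sep_time_attained[OF x y False] by blast
        then have "k \<in> K"
          using \<open>\<not> n \<le> sep_time x y\<close> by (simp add: K_def)
        then have "\<rho> x y < \<delta> k"
          using close K by simp
        then show False
          using \<delta>(2)[OF y] k(2) by fastforce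
      qed
      then have "1 / growth ^ sep_time x y \<le> 1 / growth ^ n"
        using growth_gt_1 by (intro divide_left_mono power_increasing) auto
      then show ?thesis
        using upper[OF x y False] n by linarith
    qed (use y e in auto)
    then show "\<exists>\<delta>>0. \<forall>y\<in>M. \<rho> x y < \<delta> \<longrightarrow> d x y < e"
      using K \<delta>(1) by (intro exI[of _ "Min (insert 1 (\<delta> ` K))"]) auto
  qed
  then show ?thesis
    using d growth_gt_1 self_similar by (intro exI[of _ d] exI[of _ "1/4"] exI[of _ growth]) auto
qed

end
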